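(* Let $n=(n_x:x\in J_L)$ be an $\ell$-way contingency table with marginalization function $n(\cdot)$, and let $\mathcal{L}$ be the lattice of all subsets of $L=\{1,\dots,\ell\}$. Let $C_1,\dots,C_d\in\mathcal{L}$ with $C_1\cup\cdots\cup C_d=\{1,\dots,\ell\}$. Define $S_j=(C_1\cup\cdots\cup C_{j-1})\cap C_j$ for $j=2,\dots,d$. Then $$\min\big(n(C_1),\dots,n(C_d)\big)\;\geq\; n(\{1,\dots,\ell\})\;\geq\;\max\left(\sum_{i=1}^d n(C_i)-\sum_{j=2}^d n(S_j),\,0\right),$$ where the inequalities are understood cellwise, i.e., for every $x\in J_L$.
   Context: Let $L=\{1,\dots,\ell\}$ and let $\mathcal{L}$ be the set of all subsets of $L$. For each $j\in L$ let $I_j$ be a discrete (finite or countable) set of labels, and put $J_L=I_1\times\cdots\times I_\ell$. For $a=\{i_1,\dots,i_p\}\subset L$ put $J_a=I_{i_1}\times\cdots\times I_{i_p}$; each $x\in J_L$ is written $x=(x_a,x_{L\setminus a})$ with $x_a\in J_a$, $x_{L\setminus a}\in J_{L\setminus a}$. An $\ell$-way contingency table is a family $n=(n_x:x\in J_L)$ of non-negative real numbers (typically counts) with finite total sum. The marginalization function assigns to $a\subset L$ the marginal table $n(a)=(n_{x(a),+}: x_a\in J_a)$, where $n_{x(a),+}=\sum_{y\in J_{L\setminus a}} n_{(x_a,y)}$ is obtained by summing over all coordinates outside $a$. In particular $n(\{1,\dots,\ell\})=n$ is the table itself and $n(\emptyset)=\sum_{x\in J_L} n_x$ is the total. Convention: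 indices are omitted in a statement that holds for all choices of indices. An inequality among the marginal tables $n(a)$, for various $a$, means that for every fixed $x\in J_L$ the inequality holds with each $n(a)$ replaced by the number $n_{x(a),+}$. *)

theory Defs
  imports "HOL-Analysis.Analysis"
begin

text \<open>
  The label sets are a family \<open>I :: nat \<Rightarrow> 'a set\<close>; the cells over \<open>a \<subseteq> {1..l}\<close> are the
  extensional functions on \<open>a\<close>, so that the projection \<open>x \<mapsto> x\<^sub>a\<close> is restriction and
  the pairing of cells over disjoint coordinate sets is the library's \<open>merge\<close>.
\<close>

definition cells :: "(nat \<Rightarrow> 'a set) \<Rightarrow> nat set \<Rightarrow> (nat \<Rightarrow> 'a) set" where
  "cells I a = (\<Pi>\<^sub>E j\<in>a. I j)"

text \<open>Values of \<open>n\<close> outside \<open>cells I {1..l}\<close> are irrelevant.\<close>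

definition contingency_table ::
    "nat \<Rightarrow> (nat \<Rightarrow> 'a set) \<Rightarrow> ((nat \<Rightarrow> 'a) \<Rightarrow> real) \<Rightarrow> bool" where
  "contingency_table l I n \<longleftrightarrow>
     (\<forall>j\<in>{1..l}. countable (I j)) \<and>
     (\<forall>x\<in>cells I {1..l}. 0 \<le> n x) \<and>
     n summable_on cells I {1..l}"

text \<open>
  The marginal table \<open>n(a)\<close>, a function of \<open>x\<^sub>a \<in> cells I a\<close>.
\<close>

definition marginal ::
    "nat \<Rightarrow> (nat \<Rightarrow> 'a set) \<Rightarrow> ((nat \<Rightarrow> 'a) \<Rightarrow> real) \<Rightarrow> nat set \<Rightarrow> (nat \<Rightarrow> 'a) \<Rightarrow> real" where
  "marginal l I n a xa =
     (\<Sum>\<^sub>\<infinity>y\<in>cells I ({1..l} - a). n (merge a ({1..l} - a) (xa, y)))"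

text \<open>The entry \<open>n\<^bsub>x(a),+\<^esub>\<close> of \<open>n(a)\<close> belonging to a full cell \<open>x\<close>.\<close>

definition marginal_at ::
    "nat \<Rightarrow> (nat \<Rightarrow> 'a set) \<Rightarrow> ((nat \<Rightarrow> 'a) \<Rightarrow> real) \<Rightarrow> nat set \<Rightarrow> (nat \<Rightarrow> 'a) \<Rightarrow> real" where
  "marginal_at l I n a x = marginal l I n a (restrict x a)"

definition separator :: "(nat \<Rightarrow> nat set) \<Rightarrow> nat \<Rightarrow> nat set" where
  "separator C j = (\<Union>i\<in>{1..<j}. C i) \<inter> C j"

lemma marginal_at_full:
  assumes "x \<in> cells I {1..l}"
  shows "marginal_at l I n {1..l} x = n x"
proof -
  have "merge {1..l} {} (restrict x {1..l}, \<lambda>_. undefined) = x"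
    using assms by (auto simp: cells_def merge_def fun_eq_iff PiE_def extensional_def)
  then show ?thesis
    by (simp add: marginal_at_def marginal_def cells_def)
qed

lemma marginal_at_empty:
  "marginal_at l I n {} x = (\<Sum>\<^sub>\<infinity>y\<in>cells I {1..l}. n y)"
proof -
  have "merge {} {1..l} (restrict x {}, y) = y" if "y \<in> cells I {1..l}" for y
    using that by (auto simp: cells_def merge_def fun_eq_iff PiE_def extensional_def)
  then show ?thesis
    unfolding marginal_at_def marginal_def by (auto intro!: infsum_cong)
qed

end

theory Submission
  imports Defs
begin

text \<open>
  For a fixed cell \<open>x\<close>, the number \<open>n\<^bsub>x(a),+\<^esub>\<close> is the mass of the cylinder of all cells
  agreeing with \<open>x\<close> on \<open>a\<close>. The cylinders over \<open>a\<close> and \<open>b\<close> intersect in the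
  cylinder over \<open>a \<union> b\<close> and are both contained in the one over \<open>a \<inter> b\<close>, so
  \<open>a \<mapsto> n\<^bsub>x(a),+\<^esub>\<close> is antitone and supermodular. The lower bound follows by adding
  the sets \<open>C\<^sub>j\<close> one at a time.
\<close>

definition cylinder ::
    "nat \<Rightarrow> (nat \<Rightarrow> 'a set) \<Rightarrow> (nat \<Rightarrow> 'a) \<Rightarrow> nat set \<Rightarrow> (nat \<Rightarrow> 'a) set" where
  "cylinder l I x a = {y \<in> cells I {1..l}. \<forall>j\<in>a. y j = x j}"

text \<open>Restriction to the coordinates outside \<open>a\<close> undoes the merge. Reindexing
  along this bijection turns marginals for different \<open>a\<close>, whose sums run over different
  index sets, into sums of the single function \<open>n\<close> over subsets of one space, which can
  then be compared as sets.\<close>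

lemma bij_betw_merge_cylinder:
  assumes "x \<in> cells I {1..l}" "a \<subseteq> {1..l}"
  shows "bij_betw (\<lambda>y. merge a ({1..l} - a) (restrict x a, y))
           (cells I ({1..l} - a)) (cylinder l I x a)"
proof (rule bij_betw_byWitness[where f' = "\<lambda>y. restrict y ({1..l} - a)"])
  show "\<forall>y\<in>cells I ({1..l} - a).
      restrict (merge a ({1..l} - a) (restrict x a, y)) ({1..l} - a) = y"
    by (auto simp: cells_def merge_def fun_eq_iff PiE_def extensional_def)
  show "\<forall>y\<in>cylinder l I x a.
      merge a ({1..l} - a) (restrict x a, restrict y ({1..l} - a)) = y"
    by (auto simp: cylinder_def cells_def merge_def fun_eq_iff PiE_def extensional_def)
  show "(\<lambda>y. merge a ({1..l} - a) (restrict x a, y)) ` cells I ({1..l} - a) \<subseteq> cylinder l I x a"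
    using assms
    by (auto simp: cylinder_def cells_def merge_def PiE_def extensional_def Pi_def)
  show "(\<lambda>y. restrict y ({1..l} - a)) ` cylinder l I x a \<subseteq> cells I ({1..l} - a)"
    by (auto simp: cylinder_def cells_def split: if_splits)
qed

lemma marginal_at_eq_infsum_cylinder:
  assumes "x \<in> cells I {1..l}" "a \<subseteq> {1..l}"
  shows "marginal_at l I n a x = infsum n (cylinder l I x a)"
  unfolding marginal_at_def marginal_def
  by (rule infsum_reindex_bij_betw[OF bij_betw_merge_cylinder[OF assms]])

lemma summable_on_subset_cells:
  "contingency_table l I n \<Longrightarrow> A \<subseteq> cells I {1..l} \<Longrightarrow> n summable_on A"
  unfolding contingency_table_def by (blast intro: summable_on_subset_banach)

lemma infsum_mono_cells:
  assumes "contingency_table l I n" "A \<subseteq> B" "B \<subseteq> cells I {1..l}"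
  shows "infsum n A \<le> infsum n B"
  using assms
  by (intro infsum_mono_neutral summable_on_subset_cells[OF assms(1)])
     (auto simp: contingency_table_def)

lemma marginal_at_antimono:
  assumes "contingency_table l I n" "x \<in> cells I {1..l}" "a \<subseteq> b" "b \<subseteq> {1..l}"
  shows "marginal_at l I n b x \<le> marginal_at l I n a x"
proof -
  have "infsum n (cylinder l I x b) \<le> infsum n (cylinder l I x a)"
    using assms(3) by (intro infsum_mono_cells[OF assms(1)]) (auto simp: cylinder_def)
  then show ?thesis
    using assms by (simp add: marginal_at_eq_infsum_cylinder)
qed

lemma marginal_at_supermodular:
  assumes "contingency_table l I n" "x \<in> cells I {1..l}" "a \<subseteq> {1..l}" "b \<subseteq> {1..l}"
  shows "marginal_at l I n a x + marginal_at l I n b x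
           \<le> marginal_at l I n (a \<union> b) x + marginal_at l I n (a \<inter> b) x"
proof -
  let ?E = "cylinder l I x"
  have sub: "?E c \<subseteq> cells I {1..l}" for c
    by (auto simp: cylinder_def)
  have Int: "?E a \<inter> ?E b = ?E (a \<union> b)"
    by (auto simp: cylinder_def)
  have "infsum n (?E a \<union> ?E b) = infsum n (?E a) + infsum n (?E b) - infsum n (?E a \<inter> ?E b)"
    using sub by (intro infsum_Un_Int summable_on_subset_cells[OF assms(1)]) auto
  \<comment> \<open>A cell agreeing with \<open>x\<close> on all of \<open>a\<close> or on all of
    \<open>b\<close> agrees with it on \<open>a \<inter> b\<close>.\<close>
  moreover have "infsum n (?E a \<union> ?E b) \<le> infsum n (?E (a \<inter> b))"
    by (intro infsum_mono_cells[OF assms(1)]) (auto simp: cylinder_def)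
  moreover have "a \<union> b \<subseteq> {1..l}" "a \<inter> b \<subseteq> {1..l}"
    using assms by auto
  ultimately show ?thesis
    using assms Int by (simp add: marginal_at_eq_infsum_cylinder)
qed

text \<open>Induction on \<open>m\<close>, starting at 1, where the separator sum is empty and both
  sides coincide. From there on each step adds exactly one term to each of the two sums.\<close>

lemma sum_marginal_at_le_Union:
  assumes "contingency_table l I n" "x \<in> cells I {1..l}"
    and "1 \<le> m" "\<And>i. i \<in> {1..m} \<Longrightarrow> C i \<subseteq> {1..l}"
  shows "(\<Sum>i=1..m. marginal_at l I n (C i) x) - (\<Sum>j=2..m. marginal_at l I n (separator C j) x)
           \<le> marginal_at l I n (\<Union>i\<in>{1..m}. C i) x"
  using assms(3,4)
proof (induction m rule: dec_induct)
  case base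
  then show ?case by simp
next
  case (step m)
  let ?U = "\<Union>i\<in>{1..m}. C i"
  have "?U \<subseteq> {1..l}" "C (Suc m) \<subseteq> {1..l}"
    using step.prems by (force, simp)
  \<comment> \<open>Since \<open>?U \<inter> C (Suc m)\<close> is the new separator, supermodularity
    says that the left-hand side grows by at most the increase from the marginal over
    \<open>?U\<close> to the one over \<open>?U \<union> C (Suc m)\<close>.\<close>
  note marginal_at_supermodular[OF assms(1,2) this]
  moreover have "separator C (Suc m) = ?U \<inter> C (Suc m)"
    by (simp add: separator_def atLeastLessThanSuc_atLeastAtMost)
  moreover have "(\<Union>i\<in>{1..Suc m}. C i) = ?U \<union> C (Suc m)"
    by (auto simp: atLeastAtMostSuc_conv)
  ultimately show ?case
    using step by simp
qed

theorem theorem3p3: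
  fixes l d :: nat
    and I :: "nat \<Rightarrow> 'a set"
    and n :: "(nat \<Rightarrow> 'a) \<Rightarrow> real"
    and C :: "nat \<Rightarrow> nat set"
  assumes table: "contingency_table l I n"
    and d: "1 \<le> d"
    and C_sub: "\<And>i. i \<in> {1..d} \<Longrightarrow> C i \<in> Pow {1..l}"
    and C_cover: "(\<Union>i\<in>{1..d}. C i) = {1..l}"
  shows "\<forall>x\<in>cells I {1..l}.
           Min ((\<lambda>i. marginal_at l I n (C i) x) ` {1..d}) \<ge> marginal_at l I n {1..l} x \<and>
           marginal_at l I n {1..l} x \<ge>
             max ((\<Sum>i=1..d. marginal_at l I n (C i) x)
                    - (\<Sum>j=2..d. marginal_at l I n (separator C j) x)) 0"
proof (intro ballI conjI)
  fix x assume x: "x \<in> cells I {1..l}"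
  have "marginal_at l I n {1..l} x \<le> marginal_at l I n (C i) x" if "i \<in> {1..d}" for i
    using C_sub[OF that] by (intro marginal_at_antimono[OF table x]) auto
  then show "Min ((\<lambda>i. marginal_at l I n (C i) x) ` {1..d}) \<ge> marginal_at l I n {1..l} x"
    using d by (intro Min.boundedI) auto
  have "0 \<le> marginal_at l I n {1..l} x"
    using table x unfolding marginal_at_full[OF x] contingency_table_def by blast
  \<comment> \<open>The covering hypothesis turns the union bound at \<open>m = d\<close> into a
    bound by the full table.\<close>
  moreover have "(\<Sum>i=1..d. marginal_at l I n (C i) x)
      - (\<Sum>j=2..d. marginal_at l I n (separator C j) x) \<le> marginal_at l I n {1..l} x"
    using sum_marginal_at_le_Union[OF table x d, of C] C_sub unfolding C_cover by blast
  ultimately show "marginal_at l I n {1..l} x \<ge>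
      max ((\<Sum>i=1..d. marginal_at l I n (C i) x)
             - (\<Sum>j=2..d. marginal_at l I n (separator C j) x)) 0"
    by simp
qed

end
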